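(* Let $n \ge 2$ and let $(\mathcal{F},\mathcal{G})$ be a cross-Sperner pair of families with $\mathcal{F},\mathcal{G} \subseteq 2^{[n]}$. Then $$|\mathcal{F}||\mathcal{G}| \le 2^{2n-4}.$$ This bound is best possible: the families $\mathcal{F}=\{F\in 2^{[n]} : 1 \in F,\ n \notin F\}$ and $\mathcal{G}=\{G\in 2^{[n]} : n \in G,\ 1 \notin G\}$ form a cross-Sperner pair with $|\mathcal{F}||\mathcal{G}| = 2^{2n-4}$.
   Context: $[n]=\{1,\dots,n\}$ and $2^{[n]}$ is its power set. A pair $(\mathcal{F},\mathcal{G})$ of families of sets is cross-Sperner if there exists no pair of sets $F \in \mathcal{F}$, $G \in \mathcal{G}$ with $F \subseteq G$ or $G \subseteq F$. *)

theory Defs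
  imports Main
begin

definition cross_sperner :: "'a set set \<Rightarrow> 'a set set \<Rightarrow> bool" where
  "cross_sperner \<F> \<G> \<longleftrightarrow> \<not> (\<exists>F\<in>\<F>. \<exists>G\<in>\<G>. F \<subseteq> G \<or> G \<subseteq> F)"

end

theory Submission
  imports Defs
begin

text \<open>
  Let \<open>\<M>\<close> and \<open>\<J>\<close> be the families of all \<open>F \<inter> G\<close> and of all \<open>F \<union> G\<close> with \<open>F \<in> \<F>\<close>, \<open>G \<in> \<G>\<close>.
  The cross-Sperner property makes \<open>\<F>\<close>, \<open>\<G>\<close>, \<open>\<M>\<close>, \<open>\<J>\<close> pairwise disjoint, so their sizes add up
  to at most \<open>2 ^ n\<close>, while the four functions theorem of Ahlswede and Daykin gives
  \<open>card \<F> * card \<G> \<le> card \<M> * card \<J>\<close>. If \<open>card \<F> * card \<G>\<close> exceeded \<open>(2 ^ (n - 2))\<^sup>2\<close>, then by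
  AM-GM both \<open>card \<F> + card \<G>\<close> and \<open>card \<M> + card \<J>\<close> would exceed \<open>2 * 2 ^ (n - 2)\<close>.
\<close>

text \<open>The four functions theorem on a one-element ground set: index 0 is the value at the
  empty set, index 1 the value at the singleton. Both mixed products are bounded by the same
  \<open>c0 * d1\<close>, so bounding terms one by one would count it twice.\<close>

lemma four_functions_singleton:
  fixes a0 a1 b0 b1 c0 c1 d0 d1 :: "'a::linordered_idom"
  assumes nonneg: "0 \<le> a0" "0 \<le> a1" "0 \<le> b0" "0 \<le> b1" "0 \<le> c0" "0 \<le> c1" "0 \<le> d0" "0 \<le> d1"
    and le00: "a0 * b0 \<le> c0 * d0" and le01: "a0 * b1 \<le> c0 * d1"
    and le10: "a1 * b0 \<le> c0 * d1" and le11: "a1 * b1 \<le> c1 * d1"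
  shows "(a0 + a1) * (b0 + b1) \<le> (c0 + c1) * (d0 + d1)"
proof -
  define p q r where "p = c0 * d1" and "q = a0 * b1" and "r = a1 * b0"
  have qp: "q \<le> p" and rp: "r \<le> p" and q0: "0 \<le> q" and r0: "0 \<le> r"
    using assms by (simp_all add: p_def q_def r_def)
  have s0: "0 \<le> c1 * d0"
    using nonneg by simp
  \<comment> \<open>This compares the mixed terms; \<open>le00\<close> and \<open>le11\<close>
    settle the others. For \<open>p > 0\<close>, expanding \<open>(p - q) * (p - r) \<ge> 0\<close>
    gives \<open>p * (q + r) \<le> p * p + q * r\<close>, and
    \<open>q * r \<le> p * (c1 * d0)\<close> lets \<open>p\<close> be cancelled.\<close>
  have "q + r \<le> p + c1 * d0"
  proof (cases "p = 0")
    case True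
    with qp rp s0 show ?thesis by simp
  next
    case False
    with q0 qp have p_pos: "0 < p" by simp
    have "q * r = (a0 * b0) * (a1 * b1)"
      by (simp add: q_def r_def algebra_simps)
    also have "\<dots> \<le> (c0 * d0) * (c1 * d1)"
      using nonneg by (intro mult_mono[OF le00 le11]) simp_all
    also have "\<dots> = p * (c1 * d0)"
      by (simp add: p_def algebra_simps)
    finally have "q * r \<le> p * (c1 * d0)" .
    moreover have "0 \<le> (p - q) * (p - r)"
      using qp rp by simp
    ultimately have "p * (q + r) \<le> p * (p + c1 * d0)"
      by (simp add: algebra_simps)
    with p_pos show ?thesis by simp
  qed
  with le00 le11 show ?thesis
    by (simp add: p_def q_def r_def algebra_simps)
qed

lemma sum_Pow_insert:
  fixes f :: "'a set \<Rightarrow> 'b::comm_monoid_add"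
  assumes "finite S" "x \<notin> S"
  shows "sum f (Pow (insert x S)) = (\<Sum>A\<in>Pow S. f A + f (insert x A))"
proof -
  have "inj_on (insert x) (Pow S)"
    using assms by (auto simp: inj_on_def)
  moreover have "Pow S \<inter> insert x ` Pow S = {}"
    using assms by auto
  ultimately show ?thesis
    using assms by (simp add: Pow_insert sum.union_disjoint sum.reindex sum.distrib)
qed

theorem four_functions:
  fixes \<alpha> \<beta> \<gamma> \<delta> :: "'a set \<Rightarrow> 'b::linordered_idom"
  assumes "finite S"
    and "\<And>A. A \<subseteq> S \<Longrightarrow> 0 \<le> \<alpha> A" "\<And>A. A \<subseteq> S \<Longrightarrow> 0 \<le> \<beta> A"
      "\<And>A. A \<subseteq> S \<Longrightarrow> 0 \<le> \<gamma> A" "\<And>A. A \<subseteq> S \<Longrightarrow> 0 \<le> \<delta> A"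
    and "\<And>A B. A \<subseteq> S \<Longrightarrow> B \<subseteq> S \<Longrightarrow> \<alpha> A * \<beta> B \<le> \<gamma> (A \<inter> B) * \<delta> (A \<union> B)"
  shows "sum \<alpha> (Pow S) * sum \<beta> (Pow S) \<le> sum \<gamma> (Pow S) * sum \<delta> (Pow S)"
  using assms
proof (induction S arbitrary: \<alpha> \<beta> \<gamma> \<delta> rule: finite_induct)
  case empty
  from empty.prems(5)[of "{}" "{}"] show ?case by simp
next
  case (insert x S)
  have sub: "A \<subseteq> insert x S" "insert x A \<subseteq> insert x S" if "A \<subseteq> S" for A
    using that by auto
  note nonneg = insert.prems(1-4)
  show ?case
    unfolding sum_Pow_insert[OF insert.hyps]
  \<comment> \<open>The induction hypothesis is applied to the functions
    \<open>A \<mapsto> f A + f (insert x A)\<close> on \<open>Pow S\<close>; their product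
    inequality is the singleton case.\<close>
  proof (rule insert.IH)
    fix A B assume AB: "A \<subseteq> S" "B \<subseteq> S"
    then have x: "x \<notin> A" "x \<notin> B"
      using insert.hyps by auto
    have AB': "A \<inter> B \<subseteq> S" "A \<union> B \<subseteq> S"
      using AB by auto
    show "(\<alpha> A + \<alpha> (insert x A)) * (\<beta> B + \<beta> (insert x B))
        \<le> (\<gamma> (A \<inter> B) + \<gamma> (insert x (A \<inter> B))) * (\<delta> (A \<union> B) + \<delta> (insert x (A \<union> B)))"
      \<comment> \<open>One instance for each choice of which sets receive \<open>x\<close>. If
        exactly one does, the intersection lacks \<open>x\<close> and the union has it, which yields
        the bound \<open>c0 * d1\<close> twice.\<close>
      using insert.prems(5)[OF sub(1)[OF AB(1)] sub(1)[OF AB(2)]]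
        insert.prems(5)[OF sub(1)[OF AB(1)] sub(2)[OF AB(2)]]
        insert.prems(5)[OF sub(2)[OF AB(1)] sub(1)[OF AB(2)]]
        insert.prems(5)[OF sub(2)[OF AB(1)] sub(2)[OF AB(2)]] x
      by (intro four_functions_singleton nonneg sub AB AB') simp_all
  qed (intro add_nonneg_nonneg nonneg sub; assumption)+
qed

text \<open>Apply \<open>four_functions\<close> to the indicator functions of the four families.
  They are integer-valued because \<open>nat\<close> is not a
  \<open>linordered_idom\<close>.\<close>

corollary card_mult_le_card_Int_mult_card_Un:
  assumes "finite S" "\<F> \<subseteq> Pow S" "\<G> \<subseteq> Pow S"
  shows "card \<F> * card \<G> \<le> card {F \<inter> G |F G. F \<in> \<F> \<and> G \<in> \<G>} * card {F \<union> G |F G. F \<in> \<F> \<and> G \<in> \<G>}"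
    (is "_ \<le> card ?M * card ?J")
proof -
  define ind :: "'a set set \<Rightarrow> 'a set \<Rightarrow> int" where "ind \<A> A = of_bool (A \<in> \<A>)" for \<A> A
  have sum_ind: "sum (ind \<A>) (Pow S) = int (card \<A>)" if "\<A> \<subseteq> Pow S" for \<A>
  proof -
    have "sum (ind \<A>) (Pow S) = (\<Sum>A\<in>\<A>. 1)"
      using that \<open>finite S\<close> by (intro sum.mono_neutral_cong_right) (auto simp: ind_def)
    then show ?thesis by simp
  qed
  have MJ: "?M \<subseteq> Pow S" "?J \<subseteq> Pow S"
    using assms by auto
  have "sum (ind \<F>) (Pow S) * sum (ind \<G>) (Pow S) \<le> sum (ind ?M) (Pow S) * sum (ind ?J) (Pow S)"
    using \<open>finite S\<close> by (rule four_functions) (auto simp: ind_def)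
  then have "int (card \<F> * card \<G>) \<le> int (card ?M * card ?J)"
    by (simp only: sum_ind assms MJ of_nat_mult)
  then show ?thesis
    by (simp only: of_nat_le_iff)
qed

text \<open>AM-GM in the form \<open>4 * a * b = (a + b)\<^sup>2 - (a - b)\<^sup>2\<close>, carried
  out over \<open>int\<close> so that the difference is not truncated.\<close>

lemma two_mult_less_add_if_square_less_mult:
  fixes a b t :: nat
  assumes "t\<^sup>2 < a * b"
  shows "2 * t < a + b"
proof (rule ccontr)
  assume "\<not> 2 * t < a + b"
  then have "int a + int b \<le> 2 * int t" by simp
  then have "(int a + int b)\<^sup>2 \<le> (2 * int t)\<^sup>2"
    by (intro power_mono) simp_all
  moreover have "int (t\<^sup>2) < int (a * b)"
    using assms by (simp only: of_nat_less_iff)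
  moreover have "0 \<le> (int a - int b)\<^sup>2" by simp
  ultimately show False
    by (simp add: power2_eq_square algebra_simps)
qed

lemma cross_sperner_card_bound:
  assumes "finite S" "\<F> \<subseteq> Pow S" "\<G> \<subseteq> Pow S" "cross_sperner \<F> \<G>" "2 ^ card S = 4 * t"
  shows "card \<F> * card \<G> \<le> t\<^sup>2"
proof (rule ccontr)
  define \<M> \<J> where "\<M> = {F \<inter> G |F G. F \<in> \<F> \<and> G \<in> \<G>}" and "\<J> = {F \<union> G |F G. F \<in> \<F> \<and> G \<in> \<G>}"
  assume "\<not> card \<F> * card \<G> \<le> t\<^sup>2"
  then have fg: "t\<^sup>2 < card \<F> * card \<G>" by simp
  also have "\<dots> \<le> card \<M> * card \<J>"
    unfolding \<M>_def \<J>_def using assms(1-3) by (rule card_mult_le_card_Int_mult_card_Un)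
  finally have mj: "t\<^sup>2 < card \<M> * card \<J>" .
  have incomparable: "\<not> F \<subseteq> G" "\<not> G \<subseteq> F" if "F \<in> \<F>" "G \<in> \<G>" for F G
    using assms(4) that by (auto simp: cross_sperner_def)
  have sub: "\<F> \<union> \<G> \<union> (\<M> \<union> \<J>) \<subseteq> Pow S"
    using assms(2,3) by (auto simp: \<M>_def \<J>_def)
  then have fin: "finite \<F>" "finite \<G>" "finite \<M>" "finite \<J>"
    using \<open>finite S\<close> by (auto intro: finite_subset[of _ "Pow S"])
  have "\<F> \<inter> \<G> = {}"
    using incomparable by blast
  moreover have "\<M> \<inter> \<J> = {}"
  proof -
    \<comment> \<open>Equality would give
      \<open>F' \<subseteq> F' \<union> G' = F \<inter> G \<subseteq> G\<close>.\<close>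
    have "F \<inter> G \<noteq> F' \<union> G'" if "F \<in> \<F>" "G \<in> \<G>" "F' \<in> \<F>" "G' \<in> \<G>" for F G F' G'
      using incomparable(1)[of F' G] that by blast
    then show ?thesis by (auto simp: \<M>_def \<J>_def)
  qed
  moreover have "(\<F> \<union> \<G>) \<inter> (\<M> \<union> \<J>) = {}"
  proof -
    \<comment> \<open>The sets \<open>F \<inter> G\<close> and \<open>F \<union> G\<close> are
      comparable with both \<open>F\<close> and \<open>G\<close>, so membership in either family
      would create a forbidden pair.\<close>
    have "F \<inter> G \<notin> \<F>" "F \<inter> G \<notin> \<G>" "F \<union> G \<notin> \<F>" "F \<union> G \<notin> \<G>" if "F \<in> \<F>" "G \<in> \<G>" for F G
      using incomparable[of "F \<inter> G" G] incomparable[of F "F \<inter> G"]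
        incomparable[of "F \<union> G" G] incomparable[of F "F \<union> G"] that by auto
    then show ?thesis by (auto simp: \<M>_def \<J>_def)
  qed
  ultimately have "card \<F> + card \<G> + (card \<M> + card \<J>) = card (\<F> \<union> \<G> \<union> (\<M> \<union> \<J>))"
    using fin by (simp add: card_Un_disjoint)
  also have "\<dots> \<le> 4 * t"
    using card_mono[OF _ sub] \<open>finite S\<close> assms(5) by (simp add: card_Pow)
  finally show False
    using two_mult_less_add_if_square_less_mult[OF fg]
      two_mult_less_add_if_square_less_mult[OF mj] by linarith
qed

lemma card_subsets_containing_avoiding:
  assumes "finite S" "x \<in> S" "y \<in> S" "x \<noteq> y"
  shows "card {A \<in> Pow S. x \<in> A \<and> y \<notin> A} = 2 ^ (card S - 2)"
proof -
  have "{A \<in> Pow S. x \<in> A \<and> y \<notin> A} = insert x ` Pow (S - {x, y})" (is "?L = ?R")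
  proof
    show "?L \<subseteq> ?R"
    proof
      fix A assume "A \<in> ?L"
      then have "A = insert x (A - {x})" "A - {x} \<in> Pow (S - {x, y})" by auto
      then show "A \<in> ?R" by (rule image_eqI)
    qed
    show "?R \<subseteq> ?L" using assms by auto
  qed
  moreover have "inj_on (insert x) (Pow (S - {x, y}))"
    by (auto simp: inj_on_def)
  moreover have "card (S - {x, y}) = card S - 2"
    using assms by (simp add: card_Diff_subset)
  ultimately show ?thesis
    using assms by (simp add: card_image card_Pow)
qed

theorem theorem1p2:
  fixes n :: nat
  assumes "n \<ge> 2"
  shows "(\<forall>\<F> \<G>. \<F> \<subseteq> Pow {1..n} \<longrightarrow> \<G> \<subseteq> Pow {1..n} \<longrightarrow> cross_sperner \<F> \<G> \<longrightarrow>
            card \<F> * card \<G> \<le> 2 ^ (2 * n - 4)) \<and>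
         (let \<F> = {F \<in> Pow {1..n}. 1 \<in> F \<and> n \<notin> F};
              \<G> = {G \<in> Pow {1..n}. n \<in> G \<and> 1 \<notin> G}
          in cross_sperner \<F> \<G> \<and> card \<F> * card \<G> = 2 ^ (2 * n - 4))"
proof -
  \<comment> \<open>Writing \<open>n\<close> as \<open>m + 2\<close> removes the truncated
    subtractions in \<open>n - 2\<close> and \<open>2 * n - 4\<close>.\<close>
  obtain m where n: "n = m + 2"
    using assms by (metis add.commute le_Suc_ex)
  have pow: "2 ^ (2 * n - 4) = (2 ^ (n - 2) :: nat)\<^sup>2"
    by (simp add: n power_mult[symmetric] mult.commute)
  have "2 ^ card {1..n} = 4 * (2 ^ (n - 2) :: nat)"
    by (simp add: n)
  then have bound: "card \<F> * card \<G> \<le> 2 ^ (2 * n - 4)"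
    if "\<F> \<subseteq> Pow {1..n}" "\<G> \<subseteq> Pow {1..n}" "cross_sperner \<F> \<G>" for \<F> \<G>
    unfolding pow using that by (intro cross_sperner_card_bound) auto
  have "card {F \<in> Pow {1..n}. 1 \<in> F \<and> n \<notin> F} = 2 ^ (n - 2)"
    using card_subsets_containing_avoiding[of "{1..n}" 1 n] assms by simp
  moreover have "card {G \<in> Pow {1..n}. n \<in> G \<and> 1 \<notin> G} = 2 ^ (n - 2)"
    using card_subsets_containing_avoiding[of "{1..n}" n 1] assms by simp
  \<comment> \<open>The element 1 witnesses that \<open>F\<close> is not inside \<open>G\<close>,
    and \<open>n\<close> that \<open>G\<close> is not inside \<open>F\<close>.\<close>
  moreover have "cross_sperner {F \<in> Pow {1..n}. 1 \<in> F \<and> n \<notin> F} {G \<in> Pow {1..n}. n \<in> G \<and> 1 \<notin> G}"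
    by (auto simp: cross_sperner_def)
  ultimately show ?thesis
    using bound unfolding Let_def pow by (simp add: power2_eq_square)
qed

end
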